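(* Upon termination, the base algorithm returns a hypothesis $\mathcal{H}$ that is equivalent (up to isomorphism) to the target automaton $\mathcal{M}$; that is, $\mathcal{H}$ and $\mathcal{M}$ are isomorphic as Mealy machines.
   Context: **Mealy machines.** A Mealy machine is $\mathcal{M}=\langle S,s_0,I,O,\delta,\lambda\rangle$ with non-empty state set $S$, initial state $s_0$, finite alphabets $I,O$, $\delta:S\times I\to S$, $\lambda:S\times I\to O$. Both are extended to words: $\delta(s,aw)=\delta(\delta(s,a),w)$, $\lambda(s,aw)=\lambda(s,a)\lambda(\delta(s,a),w)$, $\delta(s,\varepsilon)=s$, $\lambda(s,\varepsilon)=\varepsilon$; write $\delta(w)=\delta(s_0,w)$, $\lambda(w)=\lambda(s_0,w)$. Two machines are equivalent if they produce the same output word for every input word; they are isomorphic if there is a bijection of states preserving initial state, transitions and outputs. The unknown target system $\mathcal{M}$ is finite, deterministic, complete and minimal (no equivalent machine has fewer states). **Queries.** A reset query puts $\mathcal{M}$ into its initial state; a symbol query executes one input symbol on $\mathcal{M}$ and returns the output symbol. A membership query $mq(w)=\lambda_{\mathcal{M}}(w)$ is a reset query followed by the symbol queries of $w$; $mq(u,v)$ is the last $|v|$ symbols of $mq(uv)$. An equivalence query for a hypothesis $\mathcal{H}$ either confirms equivalence or returns a counterexample $\langle w,\lambda_{\mathcal{M}}(w)\rangle$ with $\lambda_{\mathcal{H}}(w)\ne\lambda_{\mathcal{M}}(w)$. **Adaptive discrimination tree (ADT) $\mathcal{T}$.** A rooted tree of symbol nodes (each with an input symbol; edges to children carry pairwise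 distinct output symbols), reset nodes (exactly one child, unlabelled edge) and final nodes (exactly the leaves, each referencing a hypothesis state). It is a single final node or its root is a symbol node. For a node $x$, cut the root-to-$x$ path at its reset nodes; each segment of symbol nodes yields a pair $\langle i,o\rangle$ of the input word of its symbol nodes and the output word of the edges leaving them along the path. $traces(x)$ is the set of these pairs. **Sift$(w)$** (called with $\mathcal{M}$ in state $\delta_{\mathcal{M}}(w)$): start at the root; at a symbol node pose its symbol query and follow the edge labelled with the output (if there is none, create it, leading to a new final node without reference); at a reset node pose a reset query, then the symbols of $w$, and go to the child; at a final node return it. **Base algorithm.** It maintains a hypothesis $\mathcal{H}$, an access sequence $acc(s)\in I^*$ for each state $s$ of $\mathcal{H}$, an ADT $\mathcal{T}$, a queue $Open$ of transitions $\langle s,i\rangle$ and a queue $CE$ of counterexamples. - *CloseTransitions*: while $Open\neq\emptyset$, pop $\langle s,i\rangle$; pose a reset query, the symbols of $acc(s)$, then $i$, and set $\lambda_{\mathcal{H}}(s,i)$ to the last output; let $f=$ Sift$(acc(s)\cdot i)$. If $f$ has no reference, add a new state $r$ to $\mathcal{H}$ with $acc(r)=acc(s)\cdot i$, let $f$ reference $r$, set $\delta_{\mathcal{H}}(s,i)=r$ and add all $\langle r,j\rangle$, $j\in I$, to $Open$; otherwise let $\delta_{\mathcal{H}}(s,i)$ be the state referenced by $f$. - *Initialization*: $\mathcal{H}$ has the single state $s_0$ with $acc(s_0)=\varepsilon$, $\mathcal{T}$ is a single final node referencing $s_0$; put all $\langle s_0,i\rangle$ in $Open$ and run CloseTransitions.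 - *Internal refinement* for $\langle in,out\rangle$ with $\lambda_{\mathcal{H}}(in)\ne out$: decompose, by binary search on $in$, the word as $in=uav$ with $u\in I^*$, $a\in I$, $v\in I^+$ and $mq(acc(\delta_{\mathcal{H}}(u))\cdot a,v)\neq mq(acc(\delta_{\mathcal{H}}(ua)),v)$. Let $q=\delta_{\mathcal{H}}(ua)$. Add a new state $r$ with $acc(r)=acc(\delta_{\mathcal{H}}(u))\cdot a$ and set $\delta_{\mathcal{H}}(\delta_{\mathcal{H}}(u),a)=r$. Replace the final node of $q$ in $\mathcal{T}$ by a reset node (omitted if the final node is the root) followed by the chain of symbol nodes spelling $v$, with edges labelled by the outputs $mq(acc(q),v)$ and $mq(acc(r),v)$, branching at their first difference into two final nodes referencing $q$ and $r$. Put all $\langle r,i\rangle$ ($i\in I$) and all $\langle s,i\rangle$ with $\delta_{\mathcal{H}}(s,i)=q$ in $Open$; run CloseTransitions. - *Refinement* with counterexample $c$: add $c$ to $CE$; while $CE\ne\emptyset$: (1) while $CE\neq\emptyset$, pop a counterexample $\langle in,out\rangle$ and perform internal refinements as long as $\lambda_{\mathcal{H}}(in)\ne out$; (2) for each final node $f$ of $\mathcal{T}$ referencing $s_f$ and each $\langle i,o\rangle\in traces(f)$, if $\mathcal{H}$ does not output $o$ when $i$ is applied after $acc(s_f)$, add the corresponding counterexample to $CE$. - *Main loop*: run Initialization; repeatedly pose an equivalence query for $\mathcal{H}$, performing a refinement with each returned counterexample; stop and return $\mathcal{H}$ when equivalence is confirmed. *)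

theory Defs
  imports Main
begin

section \<open>Mealy machines\<close>

text \<open>Transition and output functions are total on the underlying types; only their values on
  \<open>states \<times> inputs\<close> are relevant.\<close>

record ('s, 'i, 'o) mealy =
  states :: "'s set"
  initial :: 's
  inputs :: "'i set"
  outputs :: "'o set"
  trans :: "'s \<Rightarrow> 'i \<Rightarrow> 's"
  outp :: "'s \<Rightarrow> 'i \<Rightarrow> 'o"

definition mealy_machine :: "('s, 'i, 'o) mealy \<Rightarrow> bool" where
  "mealy_machine M \<longleftrightarrow>
     initial M \<in> states M \<and> finite (inputs M) \<and> finite (outputs M) \<and>
     (\<forall>s \<in> states M. \<forall>i \<in> inputs M. trans M s i \<in> states M \<and> outp M s i \<in> outputs M)"

fun trans_word :: "('s, 'i, 'o) mealy \<Rightarrow> 's \<Rightarrow> 'i list \<Rightarrow> 's" where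
  "trans_word M s [] = s"
| "trans_word M s (a # w) = trans_word M (trans M s a) w"

fun outp_word :: "('s, 'i, 'o) mealy \<Rightarrow> 's \<Rightarrow> 'i list \<Rightarrow> 'o list" where
  "outp_word M s [] = []"
| "outp_word M s (a # w) = outp M s a # outp_word M (trans M s a) w"

abbreviation reached :: "('s, 'i, 'o) mealy \<Rightarrow> 'i list \<Rightarrow> 's" where
  "reached M w \<equiv> trans_word M (initial M) w"

abbreviation response :: "('s, 'i, 'o) mealy \<Rightarrow> 'i list \<Rightarrow> 'o list" where
  "response M w \<equiv> outp_word M (initial M) w"

definition equivalent :: "('s, 'i, 'o) mealy \<Rightarrow> ('t, 'i, 'o) mealy \<Rightarrow> bool" where
  "equivalent M N \<longleftrightarrow>
     inputs M = inputs N \<and> outputs M = outputs N \<and>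
     (\<forall>w \<in> lists (inputs M). response M w = response N w)"

definition isomorphic :: "('s, 'i, 'o) mealy \<Rightarrow> ('t, 'i, 'o) mealy \<Rightarrow> bool" where
  "isomorphic M N \<longleftrightarrow>
     inputs M = inputs N \<and> outputs M = outputs N \<and>
     (\<exists>f. bij_betw f (states M) (states N) \<and> f (initial M) = initial N \<and>
        (\<forall>s \<in> states M. \<forall>i \<in> inputs M.
           f (trans M s i) = trans N (f s) i \<and> outp M s i = outp N (f s) i))"

text \<open>The competitors \<open>N\<close> range over machines with the same state type. For finite \<open>M\<close> this is no
  restriction: a machine with fewer states than \<open>M\<close> can be renamed so that its states lie in
  \<open>states M\<close>.\<close>

definition minimal :: "('s, 'i, 'o) mealy \<Rightarrow> bool" where
  "minimal M \<longleftrightarrow>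
     \<not> (\<exists>N :: ('s, 'i, 'o) mealy. mealy_machine N \<and> equivalent N M \<and>
          finite (states N) \<and> card (states N) < card (states M))"


section \<open>Membership queries\<close>

definition mq :: "('s, 'i, 'o) mealy \<Rightarrow> 'i list \<Rightarrow> 'o list" where
  "mq M w = response M w"

definition mq_suffix :: "('s, 'i, 'o) mealy \<Rightarrow> 'i list \<Rightarrow> 'i list \<Rightarrow> 'o list" where
  "mq_suffix M u v = drop (length u) (mq M (u @ v))"


section \<open>Adaptive discrimination trees\<close>

text \<open>The children of a symbol node form a partial map from output symbols, so the edge labels are
  pairwise distinct by construction. \<open>Final None\<close> is a final node without reference.\<close>

datatype ('i, 'o, 'q) adt =
  Final "'q option"
| Reset "('i, 'o, 'q) adt"
| Symb 'i "'o \<Rightarrow> ('i, 'o, 'q) adt option"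

text \<open>A node is addressed by the labels of the edges on the path from the root to it:
  \<open>Some b\<close> is an edge with output symbol \<open>b\<close>, and \<open>None\<close> is the edge leaving a reset node.\<close>

type_synonym 'o position = "'o option list"

fun subtree_at :: "('i, 'o, 'q) adt \<Rightarrow> 'o position \<Rightarrow> ('i, 'o, 'q) adt option" where
  "subtree_at T [] = Some T"
| "subtree_at (Symb a ch) (Some b # p) =
     (case ch b of None \<Rightarrow> None | Some T \<Rightarrow> subtree_at T p)"
| "subtree_at (Reset T) (None # p) = subtree_at T p"
| "subtree_at _ _ = None"

fun replace_at ::
    "('i, 'o, 'q) adt \<Rightarrow> 'o position \<Rightarrow> ('i, 'o, 'q) adt \<Rightarrow> ('i, 'o, 'q) adt" where
  "replace_at T [] R = R"
| "replace_at (Symb a ch) (Some b # p) R =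
     Symb a (case ch b of None \<Rightarrow> ch | Some T \<Rightarrow> ch(b \<mapsto> replace_at T p R))"
| "replace_at (Reset T) (None # p) R = Reset (replace_at T p R)"
| "replace_at T _ R = T"

text \<open>The pair \<open>(u, v)\<close> accumulates the input and output word of the current segment.\<close>

fun traces_from ::
    "'i list \<Rightarrow> 'o list \<Rightarrow> ('i, 'o, 'q) adt \<Rightarrow> 'o position \<Rightarrow> ('i list \<times> 'o list) set" where
  "traces_from u v T [] = {(u, v)}"
| "traces_from u v (Symb a ch) (Some b # p) =
     (case ch b of None \<Rightarrow> {} | Some T \<Rightarrow> traces_from (u @ [a]) (v @ [b]) T p)"
| "traces_from u v (Reset T) (None # p) = insert (u, v) (traces_from [] [] T p)"
| "traces_from u v _ _ = {}"

definition traces :: "('i, 'o, 'q) adt \<Rightarrow> 'o position \<Rightarrow> ('i list \<times> 'o list) set" where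
  "traces T p = traces_from [] [] T p"

text \<open>\<open>sift M w x T p T'\<close>: sifting \<open>w\<close> through \<open>T\<close> while the target is in state \<open>x\<close> returns the final
  node at position \<open>p\<close> of \<open>T'\<close>, where \<open>T'\<close> is \<open>T\<close> together with the possibly created final node.\<close>

inductive sift ::
    "('s, 'i, 'o) mealy \<Rightarrow> 'i list \<Rightarrow> 's \<Rightarrow> ('i, 'o, 'q) adt \<Rightarrow>
     'o position \<Rightarrow> ('i, 'o, 'q) adt \<Rightarrow> bool"
  for M :: "('s, 'i, 'o) mealy" and w :: "'i list" where
  sift_final: "sift M w x (Final ref) [] (Final ref)"
| sift_edge: "ch (outp M x a) = Some T \<Longrightarrow> sift M w (trans M x a) T p T' \<Longrightarrow>
     sift M w x (Symb a ch) (Some (outp M x a) # p) (Symb a (ch(outp M x a \<mapsto> T')))"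
| sift_new_edge: "ch (outp M x a) = None \<Longrightarrow>
     sift M w x (Symb a ch) [Some (outp M x a)] (Symb a (ch(outp M x a \<mapsto> Final None)))"
| sift_reset: "sift M w (reached M w) T p T' \<Longrightarrow>
     sift M w x (Reset T) (None # p) (Reset T')"

text \<open>\<open>split_chain v xs ys q r\<close> is the chain of symbol nodes spelling \<open>v\<close> up to and including the
  first position where the output words \<open>xs\<close> (for \<open>q\<close>) and \<open>ys\<close> (for \<open>r\<close>) differ. It is only used for
  distinct output words of the same length as \<open>v\<close>.\<close>

fun split_chain ::
    "'i list \<Rightarrow> 'o list \<Rightarrow> 'o list \<Rightarrow> 'q \<Rightarrow> 'q \<Rightarrow> ('i, 'o, 'q) adt" where
  "split_chain (a # v) (x # xs) (y # ys) q r =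
     Symb a (if x = y then [x \<mapsto> split_chain v xs ys q r]
             else [x \<mapsto> Final (Some q), y \<mapsto> Final (Some r)])"
| "split_chain _ _ _ _ _ = undefined"


section \<open>The base algorithm\<close>

text \<open>The hypothesis is under construction while transitions are open, hence the partial functions
  \<open>delta\<close> and \<open>lam\<close>.\<close>

record ('q, 'i, 'o) learner =
  hstates :: "'q set"
  hinit :: 'q
  delta :: "'q \<Rightarrow> 'i \<Rightarrow> 'q option"
  lam :: "'q \<Rightarrow> 'i \<Rightarrow> 'o option"
  acc :: "'q \<Rightarrow> 'i list"
  tree :: "('i, 'o, 'q) adt"
  open_queue :: "('q \<times> 'i) list"
  ce_queue :: "('i list \<times> 'o list) list"

definition hypothesis ::
    "('s, 'i, 'o) mealy \<Rightarrow> ('q, 'i, 'o) learner \<Rightarrow> ('q, 'i, 'o) mealy" where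
  "hypothesis M C =
     \<lparr>states = hstates C, initial = hinit C, inputs = inputs M, outputs = outputs M,
      trans = (\<lambda>s i. the (delta C s i)), outp = (\<lambda>s i. the (lam C s i))\<rparr>"

definition upd2 :: "('a \<Rightarrow> 'b \<Rightarrow> 'c option) \<Rightarrow> 'a \<Rightarrow> 'b \<Rightarrow> 'c \<Rightarrow> 'a \<Rightarrow> 'b \<Rightarrow> 'c option" where
  "upd2 f s i y = f(s := (f s)(i \<mapsto> y))"

definition enumerates :: "'a list \<Rightarrow> 'a set \<Rightarrow> bool" where
  "enumerates xs A \<longleftrightarrow> distinct xs \<and> set xs = A"

text \<open>The algorithm is nondeterministic: the names of new states, the order in which a set of items
  is enqueued, the decomposition of a counterexample and the answers to equivalence queries are left
  open. It is therefore given as a relation between learner states. Loops relate a start state only to the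
  states in which they terminate.\<close>

inductive close_step ::
    "('s, 'i, 'o) mealy \<Rightarrow> ('q, 'i, 'o) learner \<Rightarrow> ('q, 'i, 'o) learner \<Rightarrow> bool"
  for M :: "('s, 'i, 'o) mealy" where
  close_known:
    "\<lbrakk>open_queue C = (s, i) # rest;
      b = last (mq M (acc C s @ [i]));
      sift M (acc C s @ [i]) (reached M (acc C s @ [i])) (tree C) p T';
      subtree_at T' p = Some (Final (Some q))\<rbrakk> \<Longrightarrow>
     close_step M C
       (C\<lparr>lam := upd2 (lam C) s i b,
          delta := upd2 (delta C) s i q,
          tree := T',
          open_queue := rest\<rparr>)"
| close_new:
    "\<lbrakk>open_queue C = (s, i) # rest;
      b = last (mq M (acc C s @ [i]));
      sift M (acc C s @ [i]) (reached M (acc C s @ [i])) (tree C) p T';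
      subtree_at T' p = Some (Final None);
      r \<notin> hstates C;
      enumerates new ({r} \<times> inputs M)\<rbrakk> \<Longrightarrow>
     close_step M C
       (C\<lparr>hstates := insert r (hstates C),
          acc := (acc C)(r := acc C s @ [i]),
          lam := upd2 (lam C) s i b,
          delta := upd2 (delta C) s i r,
          tree := replace_at T' p (Final (Some r)),
          open_queue := rest @ new\<rparr>)"

definition close_transitions ::
    "('s, 'i, 'o) mealy \<Rightarrow> ('q, 'i, 'o) learner \<Rightarrow> ('q, 'i, 'o) learner \<Rightarrow> bool" where
  "close_transitions M C C' \<longleftrightarrow> (close_step M)\<^sup>*\<^sup>* C C' \<and> open_queue C' = []"

definition initialization ::
    "('s, 'i, 'o) mealy \<Rightarrow> ('q, 'i, 'o) learner \<Rightarrow> bool" where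
  "initialization M C \<longleftrightarrow>
     (\<exists>q0 new. enumerates new ({q0} \<times> inputs M) \<and>
        close_transitions M
          \<lparr>hstates = {q0}, hinit = q0, delta = (\<lambda>s i. None), lam = (\<lambda>s i. None),
           acc = (\<lambda>s. []), tree = Final (Some q0), open_queue = new, ce_queue = []\<rparr> C)"

text \<open>\<open>s\<close>, \<open>q\<close> and \<open>r\<close> are the source, the old target and the new target of the transition
  whose target is split.\<close>

inductive internal_refinement ::
    "('s, 'i, 'o) mealy \<Rightarrow> 'i list \<Rightarrow> ('q, 'i, 'o) learner \<Rightarrow> ('q, 'i, 'o) learner \<Rightarrow> bool"
  for M :: "('s, 'i, 'o) mealy" and inw :: "'i list" where
  "\<lbrakk>inw = u @ a # v; v \<noteq> [];
    s = reached (hypothesis M C) u;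
    q = reached (hypothesis M C) (u @ [a]);
    mq_suffix M (acc C s @ [a]) v \<noteq> mq_suffix M (acc C q) v;
    r \<notin> hstates C;
    subtree_at (tree C) p = Some (Final (Some q));
    chain = split_chain v (mq_suffix M (acc C q) v) (mq_suffix M (acc C s @ [a]) v) q r;
    delta' = upd2 (delta C) s a r;
    enumerates new ({r} \<times> inputs M \<union>
      {(t, i). t \<in> hstates C \<and> i \<in> inputs M \<and> delta' t i = Some q});
    close_transitions M
      (C\<lparr>hstates := insert r (hstates C),
         acc := (acc C)(r := acc C s @ [a]),
         delta := delta',
         tree := replace_at (tree C) p (if p = [] then chain else Reset chain),
         open_queue := open_queue C @ new\<rparr>) C'\<rbrakk> \<Longrightarrow>
   internal_refinement M inw C C'"

definition is_counterexample ::
    "('s, 'i, 'o) mealy \<Rightarrow> ('q, 'i, 'o) learner \<Rightarrow> 'i list \<times> 'o list \<Rightarrow> bool" where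
  "is_counterexample M C c \<longleftrightarrow> response (hypothesis M C) (fst c) \<noteq> snd c"

definition process_counterexample ::
    "('s, 'i, 'o) mealy \<Rightarrow> 'i list \<times> 'o list \<Rightarrow>
     ('q, 'i, 'o) learner \<Rightarrow> ('q, 'i, 'o) learner \<Rightarrow> bool" where
  "process_counterexample M c C C' \<longleftrightarrow>
     (\<lambda>D D'. is_counterexample M D c \<and> internal_refinement M (fst c) D D')\<^sup>*\<^sup>* C C' \<and>
     \<not> is_counterexample M C' c"

inductive process_queue ::
    "('s, 'i, 'o) mealy \<Rightarrow> ('q, 'i, 'o) learner \<Rightarrow> ('q, 'i, 'o) learner \<Rightarrow> bool"
  for M :: "('s, 'i, 'o) mealy" where
  "ce_queue C = [] \<Longrightarrow> process_queue M C C"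
| "\<lbrakk>ce_queue C = c # rest; process_counterexample M c (C\<lparr>ce_queue := rest\<rparr>) D;
    process_queue M D C'\<rbrakk> \<Longrightarrow> process_queue M C C'"

text \<open>If the hypothesis does not reproduce a trace \<open>(i, o)\<close> stored in the tree for the state \<open>s\<close>, then
  the access sequence of \<open>s\<close> followed by \<open>i\<close> is a counterexample.\<close>

definition tree_counterexamples ::
    "('s, 'i, 'o) mealy \<Rightarrow> ('q, 'i, 'o) learner \<Rightarrow> ('i list \<times> 'o list) set" where
  "tree_counterexamples M C =
     {(acc C s @ i, mq M (acc C s) @ out) | s p i out.
        subtree_at (tree C) p = Some (Final (Some s)) \<and> (i, out) \<in> traces (tree C) p \<and>
        outp_word (hypothesis M C) (reached (hypothesis M C) (acc C s)) i \<noteq> out}"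

definition check_tree ::
    "('s, 'i, 'o) mealy \<Rightarrow> ('q, 'i, 'o) learner \<Rightarrow> ('q, 'i, 'o) learner \<Rightarrow> bool" where
  "check_tree M C C' \<longleftrightarrow>
     (\<exists>cs. set cs = tree_counterexamples M C \<and> C' = C\<lparr>ce_queue := ce_queue C @ cs\<rparr>)"

inductive refinement_loop ::
    "('s, 'i, 'o) mealy \<Rightarrow> ('q, 'i, 'o) learner \<Rightarrow> ('q, 'i, 'o) learner \<Rightarrow> bool"
  for M :: "('s, 'i, 'o) mealy" where
  "ce_queue C = [] \<Longrightarrow> refinement_loop M C C"
| "\<lbrakk>ce_queue C \<noteq> []; process_queue M C C1; check_tree M C1 C2;
    refinement_loop M C2 C'\<rbrakk> \<Longrightarrow> refinement_loop M C C'"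

definition refinement ::
    "('s, 'i, 'o) mealy \<Rightarrow> 'i list \<times> 'o list \<Rightarrow>
     ('q, 'i, 'o) learner \<Rightarrow> ('q, 'i, 'o) learner \<Rightarrow> bool" where
  "refinement M c C C' \<longleftrightarrow> refinement_loop M (C\<lparr>ce_queue := ce_queue C @ [c]\<rparr>) C'"

inductive main_loop ::
    "('s, 'i, 'o) mealy \<Rightarrow> ('q, 'i, 'o) learner \<Rightarrow> ('q, 'i, 'o) mealy \<Rightarrow> bool"
  for M :: "('s, 'i, 'o) mealy" where
  eq_confirmed: "equivalent (hypothesis M C) M \<Longrightarrow> main_loop M C (hypothesis M C)"
| eq_refuted: "\<lbrakk>w \<in> lists (inputs M); response (hypothesis M C) w \<noteq> response M w;
    refinement M (w, response M w) C D; main_loop M D H\<rbrakk> \<Longrightarrow> main_loop M C H"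

text \<open>\<open>base_algorithm_returns M H\<close>: some run of the algorithm on the target \<open>M\<close> terminates and returns
  \<open>H\<close>.\<close>

definition base_algorithm_returns ::
    "('s, 'i, 'o) mealy \<Rightarrow> ('q, 'i, 'o) mealy \<Rightarrow> bool" where
  "base_algorithm_returns M H \<longleftrightarrow> (\<exists>C. initialization M C \<and> main_loop M C H)"

end

theory Submission
  imports Defs
begin

text \<open>Sifting a word \<open>w\<close> depends on the target state reached by \<open>w\<close> only. The algorithm maintains
  that the access sequence of every hypothesis state sifts to the final node referencing that state,
  so access sequences reach pairwise distinct target states and the hypothesis never has more states
  than the target. A hypothesis equivalent to the minimal target then has exactly as many states,
  which forces an isomorphism.\<close>

section \<open>Minimal machines\<close>

lemma trans_word_append [simp]: "trans_word M x (u @ v) = trans_word M (trans_word M x u) v"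
  by (induction u arbitrary: x) auto

lemma outp_word_append [simp]:
  "outp_word M x (u @ v) = outp_word M x u @ outp_word M (trans_word M x u) v"
  by (induction u arbitrary: x) auto

lemma length_outp_word [simp]: "length (outp_word M x w) = length w"
  by (induction w arbitrary: x) auto

lemma mq_suffix_eq: "mq_suffix M u v = outp_word M (reached M u) v"
  by (simp add: mq_suffix_def mq_def)

lemma trans_word_in_states:
  assumes "mealy_machine M" "x \<in> states M" "w \<in> lists (inputs M)"
  shows "trans_word M x w \<in> states M"
  using assms(3,2) by (induction arbitrary: x) (use assms(1) in \<open>auto simp: mealy_machine_def\<close>)

lemma last_mq_in_outputs:
  assumes "mealy_machine M" "u \<in> lists (inputs M)" "i \<in> inputs M"
  shows "last (mq M (u @ [i])) \<in> outputs M"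
proof -
  have "reached M u \<in> states M"
    using assms by (intro trans_word_in_states) (auto simp: mealy_machine_def)
  with assms show ?thesis by (simp add: mq_def mealy_machine_def)
qed

section \<open>Behavioural equivalence of states\<close>

text \<open>The state types may differ, so that target states can be compared with hypothesis
  states.\<close>

definition same_behaviour ::
    "('s, 'i, 'o) mealy \<Rightarrow> 's \<Rightarrow> ('t, 'i, 'o) mealy \<Rightarrow> 't \<Rightarrow> bool" where
  "same_behaviour M x N y \<longleftrightarrow> (\<forall>w \<in> lists (inputs M). outp_word M x w = outp_word N y w)"

lemma same_behaviour_trans_word:
  assumes "same_behaviour M x N y" "u \<in> lists (inputs M)"
  shows "same_behaviour M (trans_word M x u) N (trans_word N y u)"
  unfolding same_behaviour_def
proof
  fix w assume "w \<in> lists (inputs M)"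
  with assms(2) have "u @ w \<in> lists (inputs M)" by simp
  with assms(1) have "outp_word M x (u @ w) = outp_word N y (u @ w)"
    unfolding same_behaviour_def by (rule bspec)
  then show "outp_word M (trans_word M x u) w = outp_word N (trans_word N y u) w"
    by simp
qed

lemma same_behaviour_trans:
  assumes "same_behaviour M x N y" "i \<in> inputs M"
  shows "same_behaviour M (trans M x i) N (trans N y i)"
  using same_behaviour_trans_word[OF assms(1), of "[i]"] assms(2) by simp

lemma same_behaviour_outp:
  assumes "same_behaviour M x N y" "i \<in> inputs M"
  shows "outp M x i = outp N y i"
proof -
  have "[i] \<in> lists (inputs M)" using assms(2) by simp
  with assms(1) have "outp_word M x [i] = outp_word N y [i]"
    unfolding same_behaviour_def by (rule bspec)
  then show ?thesis by simp
qed

text \<open>Merging the reachable states of equal behaviour gives a machine equivalent to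
  \<open>M\<close>, and by minimality it has at least as many states as \<open>M\<close>. Hence no
  state was unreachable and no two were merged.\<close>

lemma minimal_reachable_distinguishable:
  fixes M :: "('s, 'i, 'o) mealy"
  assumes "mealy_machine M" "finite (states M)" "minimal M"
  shows "\<forall>x \<in> states M. \<exists>w \<in> lists (inputs M). x = reached M w"
    and "\<forall>x \<in> states M. \<forall>y \<in> states M. same_behaviour M x M y \<longrightarrow> x = y"
proof -
  define R where "R = reached M ` lists (inputs M)"
  \<comment> \<open>For reachable \<open>x\<close>, a reachable representative of its behaviour
    class; the choice depends on the class alone.\<close>
  define \<rho> where "\<rho> x = (SOME y. y \<in> R \<and> same_behaviour M x M y)" for x
  have R_sub: "R \<subseteq> states M"
    using assms(1) unfolding R_def
    by (auto intro!: trans_word_in_states simp: mealy_machine_def)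
  have \<rho>: "\<rho> x \<in> R \<and> same_behaviour M x M (\<rho> x)" if "x \<in> R" for x
    unfolding \<rho>_def
    by (rule someI[of _ x]) (use that in \<open>simp add: same_behaviour_def\<close>)
  have R_trans: "trans M x i \<in> R" if x: "x \<in> R" and i: "i \<in> inputs M" for x i
  proof -
    obtain w where "w \<in> lists (inputs M)" "x = reached M w" using x by (auto simp: R_def)
    with i have "w @ [i] \<in> lists (inputs M)" "trans M x i = reached M (w @ [i])" by auto
    then show ?thesis unfolding R_def by blast
  qed
  have R_init: "initial M \<in> R" unfolding R_def by (rule image_eqI[of _ _ "[]"]) auto
  \<comment> \<open>The quotient lives on representatives instead of classes, because
    \<open>minimal\<close> compares only machines with the same state type.\<close>
  define N where "N = M\<lparr>states := \<rho> ` R, initial := \<rho> (initial M),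
    trans := (\<lambda>x i. \<rho> (trans M x i))\<rparr>"
  have N_simps: "states N = \<rho> ` R" "initial N = \<rho> (initial M)" "inputs N = inputs M"
    "outputs N = outputs M" "trans N x i = \<rho> (trans M x i)" "outp N = outp M" for x i
    by (simp_all add: N_def)
  have "\<rho> x \<in> states M" if "x \<in> R" for x using \<rho>[OF that] R_sub by auto
  then have "mealy_machine N"
    using assms(1) R_init R_trans \<rho> unfolding mealy_machine_def N_simps
    by (auto intro!: imageI)
  \<comment> \<open>Redirecting a transition to a representative of its target changes no later
    output.\<close>
  moreover have "outp_word N x w = outp_word M x w"
    if "w \<in> lists (inputs M)" "x \<in> R" for x w
    using that
  proof (induction arbitrary: x rule: lists.induct)
    case (Cons a w)
    then show ?case
      using R_trans[of x a] \<rho>[of "trans M x a"] by (auto simp: N_simps same_behaviour_def)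
  qed auto
  then have "equivalent N M"
    using \<rho>[OF R_init] unfolding equivalent_def N_simps same_behaviour_def by auto
  moreover have fin: "finite R" using R_sub assms(2) finite_subset by blast
  ultimately have card: "card (states M) \<le> card (\<rho> ` R)"
    using assms(3) unfolding minimal_def by (metis N_simps(1) finite_imageI leI)
  have sub: "\<rho> ` R \<subseteq> R" using \<rho> by auto
  \<comment> \<open>The image of \<open>R\<close> under \<rho> lies in \<open>R\<close>, which lies
    in \<open>states M\<close>. The image is at least as large as the finite set
    \<open>states M\<close>, so all three coincide.\<close>
  have "\<rho> ` R = states M"
    using card sub R_sub assms(2) by (meson card_seteq order_trans)
  then have R: "R = states M" and surj: "\<rho> ` states M = states M" using sub R_sub by auto
  show "\<forall>x \<in> states M. \<exists>w \<in> lists (inputs M). x = reached M w" using R unfolding R_def by auto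
  have inj: "inj_on \<rho> (states M)" using surj assms(2) by (simp add: eq_card_imp_inj_on)
  show "\<forall>x \<in> states M. \<forall>y \<in> states M. same_behaviour M x M y \<longrightarrow> x = y"
  proof (intro ballI impI)
    fix x y assume xy: "x \<in> states M" "y \<in> states M" "same_behaviour M x M y"
    then have "same_behaviour M x M = same_behaviour M y M"
      by (auto simp: same_behaviour_def fun_eq_iff)
    then have "\<rho> x = \<rho> y" by (simp add: \<rho>_def)
    then show "x = y" using inj xy by (auto dest: inj_onD)
  qed
qed

section \<open>From equivalence to isomorphism\<close>

text \<open>Every target state is reached by some word and is matched with a hypothesis state of the
  same behaviour, such as the one reached by that word. Distinguishability makes the matching
  injective, and the bound on the number of states makes it bijective.\<close>

lemma equivalent_minimal_imp_isomorphic: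
  fixes M :: "('s, 'i, 'o) mealy" and H :: "('q, 'i, 'o) mealy"
  assumes M: "mealy_machine M" "finite (states M)" "minimal M"
    and H: "mealy_machine H" "finite (states H)" "card (states H) \<le> card (states M)"
    and eq: "equivalent H M"
  shows "isomorphic H M"
proof -
  have io: "inputs H = inputs M" "outputs H = outputs M"
    using eq by (auto simp: equivalent_def)
  have init: "same_behaviour M (initial M) H (initial H)"
    using eq by (auto simp: equivalent_def same_behaviour_def)
  have "\<exists>s \<in> states H. same_behaviour M x H s" if x: "x \<in> states M" for x
  proof -
    obtain w where w: "w \<in> lists (inputs M)" "x = reached M w"
      using minimal_reachable_distinguishable(1)[OF M] x by blast
    have "reached H w \<in> states H"
      using H(1) w(1) io by (intro trans_word_in_states) (auto simp: mealy_machine_def)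
    moreover have "same_behaviour M x H (reached H w)"
      unfolding w(2) by (rule same_behaviour_trans_word[OF init w(1)])
    ultimately show ?thesis by blast
  qed
  then obtain h where h: "\<And>x. x \<in> states M \<Longrightarrow> h x \<in> states H"
    "\<And>x. x \<in> states M \<Longrightarrow> same_behaviour M x H (h x)" by metis
  \<comment> \<open>A target state is determined by its behaviour; this is what identifies the
    images of the initial state and of successors below.\<close>
  have same_eq: "x = y"
    if "x \<in> states M" "y \<in> states M" "same_behaviour M x H s" "same_behaviour M y H s" for x y s
    using minimal_reachable_distinguishable(2)[OF M] that by (auto simp: same_behaviour_def)
  have inj: "inj_on h (states M)"
    by (rule inj_onI) (metis h(2) same_eq)
  have surj: "h ` states M = states H"
    using h(1) H(2,3) inj by (intro card_seteq) (auto simp: card_image)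
  \<comment> \<open>The matching starts from the target, whose states are all known to be reachable;
    the isomorphism is its inverse.\<close>
  define f where "f = inv_into (states M) h"
  have bij: "bij_betw f (states H) (states M)"
    unfolding f_def by (rule bij_betw_inv_into) (use inj surj in \<open>simp add: bij_betw_def\<close>)
  have f_in: "f s \<in> states M" and f_same: "same_behaviour M (f s) H s" if "s \<in> states H" for s
  proof -
    have s: "s \<in> h ` states M" using that surj by simp
    show "f s \<in> states M" unfolding f_def by (rule inv_into_into[OF s])
    then show "same_behaviour M (f s) H s"
      using h(2)[of "f s"] f_inv_into_f[OF s] by (simp add: f_def)
  qed
  have HM: "initial H \<in> states H" "initial M \<in> states M"
    using H(1) M(1) by (auto simp: mealy_machine_def)
  have "f (initial H) = initial M"
    using same_eq[OF f_in[OF HM(1)] HM(2) f_same[OF HM(1)] init] .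
  moreover have "f (trans H s i) = trans M (f s) i \<and> outp H s i = outp M (f s) i"
    if s: "s \<in> states H" and i: "i \<in> inputs H" for s i
  proof
    have t: "trans H s i \<in> states H" "trans M (f s) i \<in> states M"
      using H(1) M(1) s i f_in[OF s] io by (auto simp: mealy_machine_def)
    show "f (trans H s i) = trans M (f s) i"
      using same_eq[OF f_in[OF t(1)] t(2) f_same[OF t(1)]]
        same_behaviour_trans[OF f_same[OF s]] i io by simp
    show "outp H s i = outp M (f s) i"
      using same_behaviour_outp[OF f_same[OF s]] i io by simp
  qed
  ultimately show ?thesis using bij io unfolding isomorphic_def by blast
qed

section \<open>Sifting as a function of the target state\<close>

text \<open>\<open>follows M y x T p\<close>: from the root of \<open>T\<close>, a target in state \<open>x\<close> that resets to \<open>y\<close> takes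
  the path \<open>p\<close>.\<close>

fun follows ::
    "('s, 'i, 'o) mealy \<Rightarrow> 's \<Rightarrow> 's \<Rightarrow> ('i, 'o, 'q) adt \<Rightarrow> 'o position \<Rightarrow> bool" where
  "follows M y x T [] \<longleftrightarrow> True"
| "follows M y x (Symb a ch) (Some b # p) \<longleftrightarrow>
     b = outp M x a \<and> (case ch b of None \<Rightarrow> False | Some T \<Rightarrow> follows M y (trans M x a) T p)"
| "follows M y x (Reset T) (None # p) \<longleftrightarrow> follows M y y T p"
| "follows M y x T p \<longleftrightarrow> False"

abbreviation leaf :: "('i, 'o, 'q) adt \<Rightarrow> 'o position \<Rightarrow> 'q \<Rightarrow> bool" where
  "leaf T p s \<equiv> subtree_at T p = Some (Final (Some s))"

text \<open>Start state and reset state are both \<open>y\<close>: sifting a word begins in the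
  state that the word reaches, and each reset followed by that word leads back to it.\<close>

definition sifts_to :: "('s, 'i, 'o) mealy \<Rightarrow> ('i, 'o, 'q) adt \<Rightarrow> 's \<Rightarrow> 'q \<Rightarrow> bool" where
  "sifts_to M T y s \<longleftrightarrow> (\<exists>p. follows M y y T p \<and> leaf T p s)"

lemma subtree_at_Final [simp]:
  "subtree_at (Final ref) p = (if p = [] then Some (Final ref) else None)"
  by (cases p) auto

lemma subtree_at_Symb:
  "subtree_at (Symb a ch) p = (case p of [] \<Rightarrow> Some (Symb a ch) | None # p' \<Rightarrow> None
     | Some b # p' \<Rightarrow> (case ch b of None \<Rightarrow> None | Some T \<Rightarrow> subtree_at T p'))"
  by (auto split: list.splits option.splits)

lemma subtree_at_Reset:
  "subtree_at (Reset T) p = (case p of [] \<Rightarrow> Some (Reset T) | None # p' \<Rightarrow> subtree_at T p'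
     | Some b # p' \<Rightarrow> None)"
  by (auto split: list.splits option.splits)

lemma follows_Symb:
  "follows M y x (Symb a ch) p = (case p of [] \<Rightarrow> True | None # p' \<Rightarrow> False
     | Some b # p' \<Rightarrow> b = outp M x a \<and>
         (case ch b of None \<Rightarrow> False | Some T \<Rightarrow> follows M y (trans M x a) T p'))"
  by (auto split: list.splits option.splits)

lemma follows_Reset:
  "follows M y x (Reset T) p = (case p of [] \<Rightarrow> True | None # p' \<Rightarrow> follows M y y T p'
     | Some b # p' \<Rightarrow> False)"
  by (auto split: list.splits option.splits)

lemmas node_simps = subtree_at_Symb subtree_at_Reset follows_Symb follows_Reset

text \<open>The target is deterministic, so the edge taken at each node is forced. Every prefix of a
  path is followed as well, hence the requirement that both positions be final nodes.\<close>

lemma follows_unique: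
  assumes "follows M y x T p" "subtree_at T p = Some (Final c)"
    and "follows M y x T p'" "subtree_at T p' = Some (Final c')"
  shows "p = p'"
  using assms
proof (induction M y x T p arbitrary: p' rule: follows.induct)
  case (1 M y x T)
  then show ?case by (auto split: if_splits)
next
  case (2 M y x a ch b p)
  from "2.prems" obtain T p'' where T: "ch b = Some T" "p' = Some b # p''"
    and p: "b = outp M x a" "follows M y (trans M x a) T p" "subtree_at T p = Some (Final c)"
    "follows M y (trans M x a) T p''" "subtree_at T p'' = Some (Final c')"
    by (auto simp: node_simps split: list.splits option.splits)
  with "2.IH"[OF T(1) p(2-5)] show ?case by simp
next
  case (3 M y x T p)
  from "3.prems" obtain p'' where "p' = None # p''"
    and p: "follows M y y T p" "subtree_at T p = Some (Final c)"
    "follows M y y T p''" "subtree_at T p'' = Some (Final c')"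
    by (auto simp: node_simps split: list.splits option.splits)
  with "3.IH"[OF p] show ?case by simp
qed auto

lemma sifts_to_unique:
  assumes "sifts_to M T y s" "sifts_to M T y t"
  shows "s = t"
  using assms unfolding sifts_to_def by (metis adt.inject(1) follows_unique option.inject)

text \<open>The path is taken in \<open>T'\<close>, since its last edge may be the one just
  created.\<close>

lemma sift_follows:
  assumes "sift M w x T p T'"
  shows "follows M (reached M w) x T' p"
  using assms by induction auto

text \<open>The only node that sifting adds is a final node without reference, on a fresh
  edge.\<close>

lemma sift_leaf:
  assumes "sift M w x T p T'"
  shows "leaf T' p' s \<longleftrightarrow> leaf T p' s"
  using assms
  by (induction arbitrary: p') (auto simp: node_simps split: list.splits option.splits)

lemma sift_follows_leaf:
  assumes "sift M w x T p T'" "leaf T p' s"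
  shows "follows M y z T' p' \<longleftrightarrow> follows M y z T p'"
  using assms
  by (induction arbitrary: p' z) (auto simp: node_simps split: list.splits option.splits if_splits)

section \<open>Input symbols occurring in a tree\<close>

text \<open>\<open>set1_adt\<close> collects the input symbols of a tree. They are tracked because
  counterexamples are read off the tree and must be words over the input alphabet.\<close>

lemma symbols_Symb_iff:
  "x \<in> set1_adt (Symb a ch) \<longleftrightarrow> x = a \<or> (\<exists>b T. ch b = Some T \<and> x \<in> set1_adt T)"
  by (auto simp: eq_commute[of "Some _"])

lemma symbols_Symb_upd:
  "set1_adt (Symb a (ch(b \<mapsto> T))) \<subseteq> set1_adt (Symb a ch) \<union> set1_adt T"
  unfolding subset_eq Un_iff symbols_Symb_iff by (auto split: if_splits)

lemma symbols_child: "ch b = Some T \<Longrightarrow> set1_adt T \<subseteq> set1_adt (Symb a ch)"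
  unfolding subset_eq symbols_Symb_iff by blast

lemma sift_symbols:
  assumes "sift M w x T p T'"
  shows "set1_adt T' \<subseteq> set1_adt T"
  using assms
proof induction
  case (sift_edge ch x a T p T')
  then show ?case using symbols_Symb_upd[of a ch "outp M x a" T'] symbols_child by fastforce
next
  case (sift_new_edge ch x a)
  then show ?case using symbols_Symb_upd[of a ch "outp M x a" "Final None"] by simp
qed auto

section \<open>Replacing a final node by a subtree\<close>

text \<open>Nothing lies below the final node at \<open>p\<close>, so the replacement removes no
  other leaf.\<close>

lemma replace_at_leaf:
  assumes "subtree_at T p = Some (Final c)"
  shows "leaf (replace_at T p R) p' s \<longleftrightarrow>
    (\<exists>p''. p' = p @ p'' \<and> leaf R p'' s) \<or> leaf T p' s \<and> p' \<noteq> p"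
  using assms
  by (induction T p R arbitrary: p' rule: replace_at.induct)
    (auto simp: node_simps split: list.splits option.splits if_splits)

text \<open>Neither of two distinct leaf positions is a prefix of the other, so the path to
  \<open>p'\<close> branches off before the replaced node.\<close>

lemma follows_replace_at_other:
  assumes "subtree_at T p = Some (Final c)" "leaf T p' s" "p' \<noteq> p"
  shows "follows M y x (replace_at T p R) p' \<longleftrightarrow> follows M y x T p'"
  using assms
  by (induction T p R arbitrary: x p' rule: replace_at.induct)
    (auto simp: node_simps split: list.splits option.splits if_splits)

text \<open>The state in which the target arrives at \<open>p\<close> is not recorded, so
  \<open>p'\<close> must be followed in \<open>R\<close> from every \<open>z\<close>. When
  \<open>R\<close> starts with a reset, the condition does not depend on \<open>z\<close>.\<close>

lemma follows_replace_at:
  assumes "subtree_at T p = Some (Final c)" "follows M y x T p" "\<And>z. follows M y z R p'"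
  shows "follows M y x (replace_at T p R) (p @ p')"
  using assms
  by (induction T p R arbitrary: x rule: replace_at.induct)
    (auto simp: node_simps split: list.splits option.splits if_splits)

lemma replace_at_symbols:
  "set1_adt (replace_at T p R) \<subseteq> set1_adt T \<union> set1_adt R"
proof (induction T p R rule: replace_at.induct)
  case (2 a ch b p R)
  show ?case
  proof (cases "ch b")
    case (Some T)
    then show ?thesis
      using 2 symbols_Symb_upd[of a ch b "replace_at T p R"] symbols_child[of ch b T a]
      by (simp only: replace_at.simps option.case) blast
  qed (simp only: replace_at.simps option.case Un_upper1)
qed auto

section \<open>The chain spelling a distinguishing word\<close>

text \<open>The two positions are the prefixes of \<open>xs\<close> and \<open>ys\<close> up to
  their first difference. The chain has no reset node, so the reset state \<open>y\<close> is
  arbitrary.\<close>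

lemma split_chain_leaves:
  assumes "length xs = length v" "length ys = length v" "xs \<noteq> ys"
  obtains p\<^sub>q p\<^sub>r
  where "\<And>p s. leaf (split_chain v xs ys q r) p s \<longleftrightarrow> p = p\<^sub>q \<and> s = q \<or> p = p\<^sub>r \<and> s = r"
    and "\<And>y x. outp_word M x v = xs \<Longrightarrow> follows M y x (split_chain v xs ys q r) p\<^sub>q"
    and "\<And>y x. outp_word M x v = ys \<Longrightarrow> follows M y x (split_chain v xs ys q r) p\<^sub>r"
  using assms
proof (induction v xs ys q r arbitrary: thesis rule: split_chain.induct)
  case (1 a v b xs b' ys q r)
  show ?case
  proof (cases "b = b'")
    case True
    with 1 obtain p p' where
       "\<And>p'' s. leaf (split_chain v xs ys q r) p'' s \<longleftrightarrow> p'' = p \<and> s = q \<or> p'' = p' \<and> s = r"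
       "\<And>y x. outp_word M x v = xs \<Longrightarrow> follows M y x (split_chain v xs ys q r) p"
       "\<And>y x. outp_word M x v = ys \<Longrightarrow> follows M y x (split_chain v xs ys q r) p'"
      by (auto elim: 1(1))
    then show ?thesis using True
      by (intro 1(2)[of "Some b # p" "Some b # p'"])
        (auto simp: node_simps split: list.splits option.splits if_splits)
  next
    case False
    then show ?thesis
      by (intro 1(2)[of "[Some b]" "[Some b']"])
        (auto simp: node_simps split: list.splits option.splits if_splits)
  qed
qed auto

lemma split_chain_symbols:
  assumes "length xs = length v" "length ys = length v" "xs \<noteq> ys"
  shows "set1_adt (split_chain v xs ys q r) \<subseteq> set v"
  using assms
  by (induction v xs ys q r rule: split_chain.induct) (auto split: if_splits)

lemma traces_from_inputs:
  assumes "(i, out) \<in> traces_from u v T p"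
  shows "set i \<subseteq> set u \<union> set1_adt T"
  using assms
proof (induction u v T p rule: traces_from.induct)
  case (2 u v a ch b p)
  then obtain T where T: "ch b = Some T" "(i, out) \<in> traces_from (u @ [a]) (v @ [b]) T p"
    by (auto split: option.splits)
  then show ?case using "2.IH"[OF T] symbols_child[of ch b T a] by auto
qed auto

section \<open>The learner invariant\<close>

text \<open>Clause \<open>closed\<close> speaks only of transitions outside the queue, because
  splitting a leaf can invalidate recorded targets until they are sifted anew. Clause
  \<open>leaf_unique\<close> identifies the leaf chosen for a split with the one to which an access
  sequence sifts.\<close>

locale learner_invariant =
  fixes M :: "('s, 'i, 'o) mealy" and C :: "('q, 'i, 'o) learner"
  assumes init: "hinit C \<in> hstates C"
    and acc_inputs: "s \<in> hstates C \<Longrightarrow> acc C s \<in> lists (inputs M)"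
    and acc_sifts: "s \<in> hstates C \<Longrightarrow> sifts_to M (tree C) (reached M (acc C s)) s"
    and leaf_unique: "leaf (tree C) p s \<Longrightarrow> leaf (tree C) p' s \<Longrightarrow> p = p'"
    and leaf_state: "leaf (tree C) p s \<Longrightarrow> s \<in> hstates C"
    and closed: "s \<in> hstates C \<Longrightarrow> i \<in> inputs M \<Longrightarrow> (s, i) \<notin> set (open_queue C) \<Longrightarrow>
      \<exists>b q. lam C s i = Some b \<and> b \<in> outputs M \<and> delta C s i = Some q \<and>
        sifts_to M (tree C) (reached M (acc C s @ [i])) q"
    and open_queue: "set (open_queue C) \<subseteq> hstates C \<times> inputs M"
    and symbols: "set1_adt (tree C) \<subseteq> inputs M"
    and ce_inputs: "c \<in> set (ce_queue C) \<Longrightarrow> fst c \<in> lists (inputs M)"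

lemma sifts_toI: "follows M y y T p \<Longrightarrow> leaf T p s \<Longrightarrow> sifts_to M T y s"
  unfolding sifts_to_def by blast

lemma sift_sifts_to:
  assumes "sift M w x T p T'" "sifts_to M T y s"
  shows "sifts_to M T' y s"
  using assms sift_leaf[OF assms(1)] sift_follows_leaf[OF assms(1)] unfolding sifts_to_def by metis

lemma replace_at_sifts_to:
  assumes "sifts_to M T y s" "subtree_at T p = Some (Final ref)" "ref \<noteq> Some s"
  shows "sifts_to M (replace_at T p R) y s"
proof -
  obtain p' where p': "follows M y y T p'" "leaf T p' s" using assms(1) by (auto simp: sifts_to_def)
  then have "p' \<noteq> p" using assms(2,3) by auto
  then show ?thesis
    using p' follows_replace_at_other[OF assms(2) p'(2), of M y y R] replace_at_leaf[OF assms(2)]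
    by (intro sifts_toI[of _ _ _ p']) auto
qed

lemma upd2_apply: "upd2 f s i y t j = (if t = s \<and> j = i then Some y else f t j)"
  by (simp add: upd2_def)

section \<open>Closing transitions\<close>

text \<open>The popped transition receives the state at the leaf to which its word sifts. If that
  leaf is fresh, the same word becomes the access sequence of the new state, which therefore sifts
  to its own leaf.\<close>

lemma close_step_invariant:
  assumes M: "mealy_machine M" and inv: "learner_invariant M C" and step: "close_step M C C'"
  shows "learner_invariant M C'"
  using step
proof cases
  case (close_known s i rest b p T' q)
  interpret learner_invariant M C by fact
  note sift = close_known(4)
  have si: "s \<in> hstates C" "i \<in> inputs M" using open_queue close_known(2) by auto
  have b: "b \<in> outputs M" using last_mq_in_outputs[OF M acc_inputs[OF si(1)] si(2)] close_known by simp
  have q: "sifts_to M T' (reached M (acc C s @ [i])) q"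
    using sift_follows[OF sift] close_known(5) by (rule sifts_toI)
  show ?thesis
  proof
    fix t j assume "t \<in> hstates C'" "j \<in> inputs M" "(t, j) \<notin> set (open_queue C')"
    then show "\<exists>b q. lam C' t j = Some b \<and> b \<in> outputs M \<and> delta C' t j = Some q \<and>
        sifts_to M (tree C') (reached M (acc C' t @ [j])) q"
      using closed[of t j] b q close_known(1,2) sift_sifts_to[OF sift]
      by (cases "(t, j) = (s, i)") (auto simp: upd2_apply)
  next
    show "set1_adt (tree C') \<subseteq> inputs M"
      using sift_symbols[OF sift] symbols close_known(1) by simp
  qed (use close_known(1,2) init acc_inputs acc_sifts leaf_unique leaf_state open_queue ce_inputs
    sift_leaf[OF sift] sift_sifts_to[OF sift] in auto)
next
  case (close_new s i rest b p T' r new)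
  interpret learner_invariant M C by fact
  note sift = close_new(4) and p = close_new(5) and r = close_new(6)
  have new: "set new = {r} \<times> inputs M" using close_new(7) by (simp add: enumerates_def)
  have si: "s \<in> hstates C" "i \<in> inputs M" using open_queue close_new(2) by auto
  have b: "b \<in> outputs M" using last_mq_in_outputs[OF M acc_inputs[OF si(1)] si(2)] close_new by simp
  define T where "T = replace_at T' p (Final (Some r))"
  have leaf_T: "leaf T p' t \<longleftrightarrow> p' = p \<and> t = r \<or> leaf (tree C) p' t \<and> p' \<noteq> p" for p' t
    using replace_at_leaf[OF p] sift_leaf[OF sift] unfolding T_def by auto
  have r_sifts: "sifts_to M T (reached M (acc C s @ [i])) r"
  proof (rule sifts_toI)
    show "follows M (reached M (acc C s @ [i])) (reached M (acc C s @ [i])) T p"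
      using follows_replace_at[OF p sift_follows[OF sift], of "Final (Some r)" "[]"]
      unfolding T_def by simp
    show "leaf T p r" by (simp add: leaf_T)
  qed
  have keep: "sifts_to M T y t" if "sifts_to M (tree C) y t" for y t
    unfolding T_def using replace_at_sifts_to[OF sift_sifts_to[OF sift that] p] by simp
  show ?thesis
  proof
    fix t assume "t \<in> hstates C'"
    then show "sifts_to M (tree C') (reached M (acc C' t)) t"
      using acc_sifts keep r_sifts r close_new(1) by (auto simp flip: T_def)
  next
    fix t assume "t \<in> hstates C'"
    then show "acc C' t \<in> lists (inputs M)"
      using acc_inputs si close_new(1) by auto
  next
    fix p' p'' t assume "leaf (tree C') p' t" "leaf (tree C') p'' t"
    then have "leaf T p' t" "leaf T p'' t" using close_new(1) by (simp_all flip: T_def)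
    then show "p' = p''" using leaf_unique leaf_state r unfolding leaf_T by metis
  next
    fix p' t assume "leaf (tree C') p' t"
    then have "leaf T p' t" using close_new(1) by (simp flip: T_def)
    then show "t \<in> hstates C'" using leaf_state close_new(1) unfolding leaf_T by auto
  next
    fix t j assume "t \<in> hstates C'" "j \<in> inputs M" "(t, j) \<notin> set (open_queue C')"
    \<comment> \<open>All transitions of \<open>r\<close> are in \<open>new\<close>, so
      \<open>t\<close> is an old state.\<close>
    then have tj: "t \<in> hstates C" "t \<noteq> r" "j \<in> inputs M" "(t, j) \<notin> set rest"
      using close_new(1) new by auto
    show "\<exists>b q. lam C' t j = Some b \<and> b \<in> outputs M \<and> delta C' t j = Some q \<and>
        sifts_to M (tree C') (reached M (acc C' t @ [j])) q"
    proof (cases "(t, j) = (s, i)")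
      case True
      then show ?thesis using b r_sifts tj close_new(1) by (auto simp: upd2_apply simp flip: T_def)
    next
      case False
      then have "(t, j) \<notin> set (open_queue C)" using tj close_new(2) by auto
      from closed[OF tj(1,3) this] show ?thesis
        using False keep tj close_new(1) by (auto simp: upd2_apply simp flip: T_def)
    qed
  next
    show "set1_adt (tree C') \<subseteq> inputs M"
      using replace_at_symbols[of T' p "Final (Some r)"] sift_symbols[OF sift] symbols close_new(1)
      by auto
  qed (use close_new(1,2) new init open_queue ce_inputs in auto)
qed

lemma close_transitions_invariant:
  assumes "mealy_machine M" "learner_invariant M C" "close_transitions M C C'"
  shows "learner_invariant M C'" and "open_queue C' = []"
proof -
  have "(close_step M)\<^sup>*\<^sup>* C C'" using assms(3) by (simp add: close_transitions_def)
  then show "learner_invariant M C'"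
    by induction (use assms(1,2) in \<open>auto intro: close_step_invariant\<close>)
qed (use assms(3) in \<open>simp add: close_transitions_def\<close>)

lemma initialization_invariant:
  fixes C :: "('q, 'i, 'o) learner"
  assumes M: "mealy_machine M" and "initialization M C"
  shows "learner_invariant M C" and "open_queue C = []"
proof -
  obtain q0 new where new: "enumerates new ({q0} \<times> inputs M)" and close: "close_transitions M
      \<lparr>hstates = {q0}, hinit = q0, delta = (\<lambda>s i. None), lam = (\<lambda>s i. None), acc = (\<lambda>s. []),
        tree = Final (Some q0), open_queue = new, ce_queue = []\<rparr> C" (is "close_transitions M ?C C")
    using assms(2) unfolding initialization_def by blast
  have "learner_invariant M ?C"
    using new by unfold_locales (auto simp: enumerates_def sifts_to_def split: if_splits)
  from close_transitions_invariant[OF M this close]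
  show "learner_invariant M C" "open_queue C = []" by blast+
qed

text \<open>With an empty queue, \<open>closed\<close> covers all transitions, and their targets are
  states because leaves reference only states.\<close>

lemma (in learner_invariant) hypothesis_mealy_machine:
  assumes "mealy_machine M" "open_queue C = []"
  shows "mealy_machine (hypothesis M C)"
  unfolding mealy_machine_def
proof (intro conjI ballI)
  fix s i assume si: "s \<in> states (hypothesis M C)" "i \<in> inputs (hypothesis M C)"
  then obtain b q where "lam C s i = Some b" "b \<in> outputs M" "delta C s i = Some q"
    "sifts_to M (tree C) (reached M (acc C s @ [i])) q"
    using closed[of s i] assms(2) by (auto simp: hypothesis_def)
  then show "trans (hypothesis M C) s i \<in> states (hypothesis M C)"
    "outp (hypothesis M C) s i \<in> outputs (hypothesis M C)"
    using leaf_state by (auto simp: hypothesis_def sifts_to_def)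
qed (use assms init in \<open>auto simp: hypothesis_def mealy_machine_def\<close>)

section \<open>Splitting a state by internal refinement\<close>

text \<open>In the old tree, the access sequence of \<open>q\<close> and the word of the split
  transition sift to the same leaf. Their responses to \<open>v\<close> differ, so after the split
  each reaches a leaf of its own.\<close>

lemma internal_refinement_invariant:
  assumes M: "mealy_machine M" and inv: "learner_invariant M C" and empty: "open_queue C = []"
    and inw: "inw \<in> lists (inputs M)" and refine: "internal_refinement M inw C C'"
  shows "learner_invariant M C'" and "open_queue C' = []"
proof -
  interpret learner_invariant M C by fact
  from refine obtain u a v s q r p chain delta' new where
    inw_eq: "inw = u @ a # v"
    and s_eq: "s = reached (hypothesis M C) u" and q_eq: "q = reached (hypothesis M C) (u @ [a])"
    and differ: "mq_suffix M (acc C s @ [a]) v \<noteq> mq_suffix M (acc C q) v"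
    and r: "r \<notin> hstates C" and p: "leaf (tree C) p q"
    and chain: "chain = split_chain v (mq_suffix M (acc C q) v) (mq_suffix M (acc C s @ [a]) v) q r"
    and delta': "delta' = upd2 (delta C) s a r"
    and new: "enumerates new ({r} \<times> inputs M \<union>
      {(t, i). t \<in> hstates C \<and> i \<in> inputs M \<and> delta' t i = Some q})"
    and close: "close_transitions M
      (C\<lparr>hstates := insert r (hstates C),
         acc := (acc C)(r := acc C s @ [a]),
         delta := delta',
         tree := replace_at (tree C) p (if p = [] then chain else Reset chain),
         open_queue := open_queue C @ new\<rparr>) C'"
    by (rule internal_refinement.cases) blast
  define R where "R = (if p = [] then chain else Reset chain)"
  define T where "T = replace_at (tree C) p R"
  define x where "x = reached M (acc C s @ [a])"
  have in_inputs: "u \<in> lists (inputs M)" "a \<in> inputs M" "set v \<subseteq> inputs M"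
    using inw inw_eq by auto
  have "s \<in> states (hypothesis M C)"
    unfolding s_eq using hypothesis_mealy_machine[OF M empty] in_inputs(1)
    by (intro trans_word_in_states) (auto simp: mealy_machine_def hypothesis_def)
  then have s: "s \<in> hstates C" by (simp add: hypothesis_def)
  \<comment> \<open>No transition is open, so \<open>closed\<close> shows that the word of the
    transition from \<open>s\<close> under \<open>a\<close> sifts to its recorded target
    \<open>q\<close>.\<close>
  have "q = the (delta C s a)" unfolding q_eq s_eq by (simp add: hypothesis_def)
  then obtain b where lam_s: "lam C s a = Some b" "b \<in> outputs M"
    and q_sifts: "sifts_to M (tree C) x q"
    using closed[OF s in_inputs(2)] empty unfolding x_def by auto
  have q: "q \<in> hstates C" using leaf_state[OF p] .
  have follows_p: "follows M y y (tree C) p" if "sifts_to M (tree C) y q" for y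
    using that leaf_unique[OF p] unfolding sifts_to_def by blast

  obtain c\<^sub>q c\<^sub>r where leaf_chain: "\<And>p t. leaf chain p t \<longleftrightarrow> p = c\<^sub>q \<and> t = q \<or> p = c\<^sub>r \<and> t = r"
    and follows_q: "\<And>y x. outp_word M x v = mq_suffix M (acc C q) v \<Longrightarrow> follows M y x chain c\<^sub>q"
    and follows_r: "\<And>y x. outp_word M x v = mq_suffix M (acc C s @ [a]) v \<Longrightarrow>
      follows M y x chain c\<^sub>r"
    using split_chain_leaves[of "mq_suffix M (acc C q) v" v "mq_suffix M (acc C s @ [a]) v" q r]
      differ unfolding chain by (auto simp: mq_suffix_eq)
  \<comment> \<open>The position in the new tree of the chain position \<open>c\<close>; away from
    the root, the step \<open>None\<close> passes the inserted reset node.\<close>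
  define ext where "ext c = p @ (if p = [] then c else None # c)" for c
  have leaf_R: "leaf R p'' t \<longleftrightarrow> (\<exists>c. p'' = (if p = [] then c else None # c) \<and> leaf chain c t)"
    for p'' t
    unfolding R_def by (auto simp: subtree_at_Reset split: list.splits option.splits)
  have leaf_T: "leaf T p' t \<longleftrightarrow>
      p' = ext c\<^sub>q \<and> t = q \<or> p' = ext c\<^sub>r \<and> t = r \<or> leaf (tree C) p' t \<and> p' \<noteq> p" for p' t
    unfolding T_def replace_at_leaf[OF p] leaf_R leaf_chain ext_def by auto
  \<comment> \<open>The reset brings the target back to \<open>y\<close> before the chain starts. At
    the root it is in \<open>y\<close> already, so there the reset can be omitted.\<close>
  have follows_T: "follows M y y T (ext c)" if "sifts_to M (tree C) y q" "follows M y y chain c" for y c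
  proof (cases "p = []")
    case False
    then show ?thesis
      using follows_replace_at[OF p follows_p[OF that(1)], of R "None # c"] that(2)
      unfolding T_def ext_def R_def by simp
  qed (use that(2) in \<open>simp add: T_def R_def ext_def\<close>)
  have q_T: "sifts_to M T (reached M (acc C q)) q"
    using follows_T[OF acc_sifts[OF q]] follows_q
    by (intro sifts_toI[of _ _ _ "ext c\<^sub>q"]) (auto simp: leaf_T mq_suffix_eq)
  have r_T: "sifts_to M T x r"
    using follows_T[OF q_sifts] follows_r
    by (intro sifts_toI[of _ _ _ "ext c\<^sub>r"]) (auto simp: leaf_T mq_suffix_eq x_def)
  have keep: "sifts_to M T y t" if "sifts_to M (tree C) y t" "t \<noteq> q" for y t
    unfolding T_def using replace_at_sifts_to[OF that(1) p] that(2) by simp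
  have symbols_T: "set1_adt T \<subseteq> inputs M"
  proof -
    have "set1_adt R \<subseteq> set v"
      using split_chain_symbols[of "mq_suffix M (acc C q) v" v "mq_suffix M (acc C s @ [a]) v" q r]
        differ unfolding R_def chain by (simp add: mq_suffix_eq)
    then show ?thesis
      using replace_at_symbols[of "tree C" p R] symbols in_inputs(3) unfolding T_def by blast
  qed

  define D where "D = C\<lparr>hstates := insert r (hstates C), acc := (acc C)(r := acc C s @ [a]),
    delta := delta', tree := T, open_queue := open_queue C @ new\<rparr>"
  have D: "hinit D = hinit C" "hstates D = insert r (hstates C)"
    "acc D = (acc C)(r := acc C s @ [a])" "delta D = delta'" "lam D = lam C" "tree D = T"
    "open_queue D = new" "ce_queue D = ce_queue C"
    using empty by (simp_all add: D_def)
  have "learner_invariant M D"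
  proof (unfold_locales, unfold D)
    fix t assume "t \<in> insert r (hstates C)"
    then show "sifts_to M T (reached M (((acc C)(r := acc C s @ [a])) t)) t"
      using acc_sifts keep q_T r_T r unfolding x_def by (cases "t = r"; cases "t = q") auto
  next
    fix p' p'' t assume "leaf T p' t" "leaf T p'' t"
    then show "p' = p''"
      using leaf_unique[OF p] leaf_unique leaf_state r q unfolding leaf_T by metis
  next
    fix p' t assume "leaf T p' t"
    then show "t \<in> insert r (hstates C)" using leaf_state q unfolding leaf_T by auto
  next
    fix t i assume ti: "t \<in> insert r (hstates C)" "i \<in> inputs M" "(t, i) \<notin> set new"
    \<comment> \<open>Transitions outside \<open>new\<close> start in an old state and do not lead
      to \<open>q\<close>, so the split leaves their targets correct. Those into \<open>q\<close>
      are queued again, as their words may answer \<open>v\<close> like \<open>q\<close>, like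
      \<open>r\<close> or like neither.\<close>
    then have t: "t \<in> hstates C" "t \<noteq> r" and not_q: "delta' t i \<noteq> Some q"
      using new r by (auto simp: enumerates_def)
    show "\<exists>b q. lam C t i = Some b \<and> b \<in> outputs M \<and> delta' t i = Some q \<and>
        sifts_to M T (reached M (((acc C)(r := acc C s @ [a])) t @ [i])) q"
    proof (cases "(t, i) = (s, a)")
      case True
      then show ?thesis using lam_s r_T t unfolding delta' x_def by (auto simp: upd2_apply)
    next
      case False
      then show ?thesis
        using closed[OF t(1) ti(2)] empty keep t not_q unfolding delta' by (auto simp: upd2_apply)
    qed
  qed (use init acc_inputs s in_inputs new ce_inputs symbols_T in \<open>auto simp: enumerates_def\<close>)
  from close_transitions_invariant[OF M this close[folded R_def, folded T_def, folded D_def]]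
  show "learner_invariant M C'" "open_queue C' = []" by blast+
qed

section \<open>Processing counterexamples and the main loop\<close>

lemma learner_invariant_ce_queue:
  assumes "learner_invariant M C" "\<And>c. c \<in> set cs \<Longrightarrow> fst c \<in> lists (inputs M)"
  shows "learner_invariant M (C\<lparr>ce_queue := cs\<rparr>)"
  using assms unfolding learner_invariant_def by simp

text \<open>The condition between two runs of closing: the empty queue makes the hypothesis a
  complete machine, which internal refinement relies on.\<close>

definition ready :: "('s, 'i, 'o) mealy \<Rightarrow> ('q, 'i, 'o) learner \<Rightarrow> bool" where
  "ready M C \<longleftrightarrow> learner_invariant M C \<and> open_queue C = []"

lemma process_counterexample_ready:
  assumes "mealy_machine M" "ready M C" "fst c \<in> lists (inputs M)" "process_counterexample M c C C'"
  shows "ready M C'"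
proof -
  have "(\<lambda>D D'. is_counterexample M D c \<and> internal_refinement M (fst c) D D')\<^sup>*\<^sup>* C C'"
    using assms(4) by (simp add: process_counterexample_def)
  then show ?thesis
  proof induction
    case (step D D')
    then show ?case
      using internal_refinement_invariant[OF assms(1) _ _ assms(3), of D D'] by (simp add: ready_def)
  qed (fact assms(2))
qed

lemma process_queue_ready:
  assumes "process_queue M C C'" "mealy_machine M" "ready M C"
  shows "ready M C'"
  using assms
proof induction
  case (2 C c rest D C')
  have inv: "learner_invariant M C" using 2 by (simp add: ready_def)
  have inputs: "fst d \<in> lists (inputs M)" if "d \<in> set (c # rest)" for d
    using learner_invariant.ce_inputs[OF inv, of d] that 2(1) by simp
  have "ready M (C\<lparr>ce_queue := rest\<rparr>)"
    using learner_invariant_ce_queue[OF inv] inputs 2 by (simp add: ready_def)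
  then show ?case using process_counterexample_ready inputs 2 by (metis list.set_intros(1))
qed

text \<open>An enqueued word is an access sequence followed by symbols of the tree, and the
  invariant keeps both within the alphabet.\<close>

lemma check_tree_ready:
  assumes "ready M C" "check_tree M C C'"
  shows "ready M C'"
proof -
  interpret learner_invariant M C using assms(1) by (simp add: ready_def)
  obtain cs where cs: "set cs = tree_counterexamples M C" "C' = C\<lparr>ce_queue := ce_queue C @ cs\<rparr>"
    using assms(2) by (auto simp: check_tree_def)
  have "fst c \<in> lists (inputs M)" if "c \<in> set cs" for c
  proof -
    from that obtain s p i out where c: "fst c = acc C s @ i" and "leaf (tree C) p s"
      and "(i, out) \<in> traces_from [] [] (tree C) p"
      by (auto simp: cs(1) tree_counterexamples_def traces_def)
    then have "acc C s \<in> lists (inputs M)" "set i \<subseteq> inputs M"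
      using acc_inputs[OF leaf_state] traces_from_inputs[of i out "[]" "[]" "tree C" p] symbols
      by auto
    then show ?thesis unfolding c by auto
  qed
  then have "learner_invariant M C'"
    unfolding cs(2) using ce_inputs
    by (intro learner_invariant_ce_queue[OF learner_invariant_axioms]) (metis Un_iff set_append)
  then show ?thesis using assms(1) by (simp add: cs(2) ready_def)
qed

lemma refinement_loop_ready:
  assumes "refinement_loop M C C'" "mealy_machine M" "ready M C"
  shows "ready M C'"
  using assms by induction (auto dest: process_queue_ready check_tree_ready)

lemma refinement_ready:
  assumes "mealy_machine M" "ready M C" "fst c \<in> lists (inputs M)" "refinement M c C C'"
  shows "ready M C'"
proof -
  have inv: "learner_invariant M C" using assms(2) by (simp add: ready_def)
  have "fst d \<in> lists (inputs M)" if "d \<in> set (ce_queue C @ [c])" for d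
    using that learner_invariant.ce_inputs[OF inv, of d] assms(3) by auto
  then have "learner_invariant M (C\<lparr>ce_queue := ce_queue C @ [c]\<rparr>)"
    by (rule learner_invariant_ce_queue[OF inv])
  then have "ready M (C\<lparr>ce_queue := ce_queue C @ [c]\<rparr>)"
    using assms(2) by (simp add: ready_def)
  then show ?thesis using refinement_loop_ready assms(1,4) unfolding refinement_def by blast
qed

text \<open>The relation holds only for terminating runs, so induction on its derivation ends at a
  confirmed equivalence query.\<close>

lemma main_loop_ready:
  assumes "main_loop M C H" "mealy_machine M" "ready M C"
  obtains D where "ready M D" "H = hypothesis M D" "equivalent H M"
  using assms
proof (induction arbitrary: thesis)
  case (eq_refuted w C D H)
  then show ?case using refinement_ready[of M C "(w, response M w)" D] by auto
qed auto

lemma (in learner_invariant) hstates_inj: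
  "inj_on (\<lambda>s. reached M (acc C s)) (hstates C)"
  by (rule inj_onI) (metis acc_sifts sifts_to_unique)

theorem theorem3:
  fixes M :: "('s, 'i, 'o) mealy" and H :: "('q, 'i, 'o) mealy"
  assumes "mealy_machine M" and "finite (states M)" and "minimal M"
    and "base_algorithm_returns M H"
  shows "mealy_machine H \<and> isomorphic H M"
proof -
  obtain C where "initialization M C" "main_loop M C H"
    using assms(4) by (auto simp: base_algorithm_returns_def)
  then obtain D where D: "ready M D" and H: "H = hypothesis M D" and eq: "equivalent H M"
    using initialization_invariant[OF assms(1)] assms(1) main_loop_ready unfolding ready_def
    by metis
  interpret learner_invariant M D using D by (simp add: ready_def)
  have machine: "mealy_machine H"
    unfolding H using hypothesis_mealy_machine assms(1) D by (simp add: ready_def)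
  \<comment> \<open>Access sequences embed the hypothesis states into the target states, which gives
    finiteness and the bound on their number.\<close>
  have "(\<lambda>s. reached M (acc D s)) ` hstates D \<subseteq> states M"
    using assms(1) acc_inputs by (auto intro!: trans_word_in_states simp: mealy_machine_def)
  then have "finite (hstates D)" "card (hstates D) \<le> card (states M)"
    using assms(2) hstates_inj by (meson finite_imageD finite_subset, metis card_inj_on_le)
  then have "finite (states H)" "card (states H) \<le> card (states M)"
    by (simp_all add: H hypothesis_def)
  with machine equivalent_minimal_imp_isomorphic[OF assms(1-3)] eq show ?thesis by blast
qed

end
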